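(* Let $G$ be a connected graph, let $k\in\{1,2\}$ (with $|V_I|\ge k$), and let $\Lambda_k=\lim_{p\to\infty}\lambda_k(\Delta_p)^{1/p}$. Then $$\Lambda_k=\frac1{R_k}\qquad\text{for } k=1,2 .$$
   Context: $G=(V,E,\omega)$ is a finite undirected weighted graph: $E\subset V\times V$ is symmetric and $\omega_{uv}=\omega_{vu}>0$ for $(u,v)\in E$; $u\sim v$ means $(u,v)\in E$. $B\subset V$ (possibly empty) is the boundary and $V_I=V\setminus B\neq\emptyset$ the set of internal nodes. $G$ is connected: if $B=\emptyset$ any two nodes are joined by a path; if $B\ne\emptyset$ the subgraph induced by $V_I$ is connected and at least one internal node is adjacent to $B$. $\mathcal H_0(V)=\{f:V\to\mathbb R:\ f=0 \text{ on } B\}$. The length of a path $v_0\sim v_1\sim\dots\sim v_n$ is $\sum_{i=1}^n\omega_{v_{i-1}v_i}^{-1}$; $d(u,v)$ is the minimal length of a path joining $u$ and $v$ (so $d(u,u)=0$), and $d_B(u)=\min_{v\in B}d(u,v)$, with $d_B\equiv+\infty$ if $B=\emptyset$. $k$-th packing radius: $R_k=\max\{r>0:\ \exists\,u_1,\dots,u_k\in V_I \text{ with } d(u_i,u_j)\ge 2r \text{ for all } i\neq j \text{ and } d_B(u_i)\ge r \text{ for all } i\}$ (if $B=\emptyset$ and $k=1$, then $R_1=+\infty$ and $1/R_1=0$). For $p\in(1,\infty)$ and $f\in\mathcal H_0(V)$: $\nabla f(u,v)=\omega_{uv}(f(v)-f(u))$, $\|\nabla f\|_p^p=\frac12\sum_{(u,v)\in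 E}|\nabla f(u,v)|^p$, $\|f\|_p^p=\sum_{u\in V}|f(u)|^p$, $\mathcal R_p(f)=\|\nabla f\|_p/\|f\|_p$ for $f\ne0$, $S_p=\{f\in\mathcal H_0(V):\|f\|_p=1\}$. The $k$-th variational eigenvalue of the $p$-Laplacian is $\lambda_k(\Delta_p)=\min_{A\in\mathcal F_k(S_p)}\max_{f\in A}\mathcal R_p(f)^p$, where $\mathcal F_k(S_p)$ is the family of closed symmetric ($A=-A$) subsets of $S_p$ with Krasnoselskii genus at least $k$. The genus of a closed symmetric set $A$ is $0$ if $A=\emptyset$, otherwise the least $h\in\mathbb N$ for which there is a continuous odd map $A\to\mathbb R^h\setminus\{0\}$ ($\infty$ if there is none). The limit $\lim_{p\to\infty}\lambda_k(\Delta_p)^{1/p}$ exists. *)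

theory Defs
  imports "HOL-Analysis.Analysis"
begin

text \<open>
  The node set \<open>V\<close> is a finite type \<open>'v\<close>, so that \<open>V\<^sub>I\<close> is \<open>- B\<close> and functions
  \<open>V \<rightarrow> \<real>\<close> are vectors in \<open>real ^ 'v\<close>. The weight \<open>\<omega>\<close> is a total function of
  which only the values on edges are used.
\<close>

definition weighted_graph :: "('v::finite \<times> 'v) set \<Rightarrow> ('v \<Rightarrow> 'v \<Rightarrow> real) \<Rightarrow> 'v set \<Rightarrow> bool" where
  "weighted_graph E \<omega> B \<longleftrightarrow>
     sym E \<and> (\<forall>(u, v)\<in>E. \<omega> u v = \<omega> v u \<and> 0 < \<omega> u v) \<and> - B \<noteq> {}"

definition connected_graph :: "('v::finite \<times> 'v) set \<Rightarrow> 'v set \<Rightarrow> bool" where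
  "connected_graph E B \<longleftrightarrow>
     (if B = {} then \<forall>u v. (u, v) \<in> E\<^sup>*
      else (\<forall>u\<in>- B. \<forall>v\<in>- B. (u, v) \<in> (E \<inter> (- B) \<times> (- B))\<^sup>*) \<and>
           (\<exists>u\<in>- B. \<exists>v\<in>B. (u, v) \<in> E))"

subsection \<open>Distances and packing radii\<close>

definition is_path :: "('v \<times> 'v) set \<Rightarrow> 'v list \<Rightarrow> bool" where
  "is_path E vs \<longleftrightarrow> vs \<noteq> [] \<and> successively (\<lambda>u v. (u, v) \<in> E) vs"

definition path_length :: "('v \<Rightarrow> 'v \<Rightarrow> real) \<Rightarrow> 'v list \<Rightarrow> real" where
  "path_length \<omega> vs = (\<Sum>i\<in>{1..<length vs}. inverse (\<omega> (vs ! (i - 1)) (vs ! i)))"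

text \<open>
  Minima and maxima are rendered as infima and suprema in \<^typ>\<open>ereal\<close>; this gives
  the value \<open>\<infinity>\<close> when no path exists, when \<open>B\<close> is empty (for \<open>boundary_dist\<close>),
  and for the packing radius with \<open>B\<close> empty and \<open>k = 1\<close>.
\<close>

definition graph_dist :: "('v \<times> 'v) set \<Rightarrow> ('v \<Rightarrow> 'v \<Rightarrow> real) \<Rightarrow> 'v \<Rightarrow> 'v \<Rightarrow> ereal" where
  "graph_dist E \<omega> u v =
     (INF vs\<in>{vs. is_path E vs \<and> hd vs = u \<and> last vs = v}. ereal (path_length \<omega> vs))"

definition boundary_dist :: "('v \<times> 'v) set \<Rightarrow> ('v \<Rightarrow> 'v \<Rightarrow> real) \<Rightarrow> 'v set \<Rightarrow> 'v \<Rightarrow> ereal" where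
  "boundary_dist E \<omega> B u = (INF v\<in>B. graph_dist E \<omega> u v)"

definition packing_radius :: "('v \<times> 'v) set \<Rightarrow> ('v \<Rightarrow> 'v \<Rightarrow> real) \<Rightarrow> 'v set \<Rightarrow> nat \<Rightarrow> ereal" where
  "packing_radius E \<omega> B k =
     (SUP r\<in>{r::real. 0 < r \<and>
        (\<exists>u::nat \<Rightarrow> 'v. (\<forall>i<k. u i \<in> - B) \<and>
           (\<forall>i<k. \<forall>j<k. i \<noteq> j \<longrightarrow> ereal (2 * r) \<le> graph_dist E \<omega> (u i) (u j)) \<and>
           (\<forall>i<k. ereal r \<le> boundary_dist E \<omega> B (u i)))}. ereal r)"

subsection \<open>The variational eigenvalues of the \<open>p\<close>-Laplacian\<close>

definition H0 :: "'v set \<Rightarrow> (real ^ 'v::finite) set" where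
  "H0 B = {f. \<forall>u\<in>B. f $ u = 0}"

definition grad :: "('v \<Rightarrow> 'v \<Rightarrow> real) \<Rightarrow> real ^ 'v::finite \<Rightarrow> 'v \<Rightarrow> 'v \<Rightarrow> real" where
  "grad \<omega> f u v = \<omega> u v * (f $ v - f $ u)"

definition p_norm :: "real \<Rightarrow> real ^ 'v::finite \<Rightarrow> real" where
  "p_norm p f = (\<Sum>u\<in>UNIV. \<bar>f $ u\<bar> powr p) powr (1 / p)"

definition grad_p_norm ::
  "('v::finite \<times> 'v) set \<Rightarrow> ('v \<Rightarrow> 'v \<Rightarrow> real) \<Rightarrow> real \<Rightarrow> real ^ 'v \<Rightarrow> real" where
  "grad_p_norm E \<omega> p f = ((\<Sum>(u, v)\<in>E. \<bar>grad \<omega> f u v\<bar> powr p) / 2) powr (1 / p)"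

definition rayleigh ::
  "('v::finite \<times> 'v) set \<Rightarrow> ('v \<Rightarrow> 'v \<Rightarrow> real) \<Rightarrow> real \<Rightarrow> real ^ 'v \<Rightarrow> real" where
  "rayleigh E \<omega> p f = grad_p_norm E \<omega> p f / p_norm p f"

definition p_sphere :: "'v set \<Rightarrow> real \<Rightarrow> (real ^ 'v::finite) set" where
  "p_sphere B p = {f \<in> H0 B. p_norm p f = 1}"

definition odd_map_to_punctured ::
  "'a::real_normed_vector set \<Rightarrow> nat \<Rightarrow> ('a \<Rightarrow> nat \<Rightarrow> real) \<Rightarrow> bool" where
  "odd_map_to_punctured A h \<phi> \<longleftrightarrow>
     continuous_map (top_of_set A) (subtopology (Euclidean_space h) (- {\<lambda>_. 0})) \<phi> \<and>
     (\<forall>f\<in>A. \<phi> (- f) = (\<lambda>i. - \<phi> f i))"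

definition genus :: "'a::real_normed_vector set \<Rightarrow> enat" where
  "genus A = (if A = {} then 0
              else Inf {enat h | h. \<exists>\<phi>. odd_map_to_punctured A h \<phi>})"

definition genus_family :: "'v set \<Rightarrow> real \<Rightarrow> nat \<Rightarrow> (real ^ 'v::finite) set set" where
  "genus_family B p k =
     {A. A \<subseteq> p_sphere B p \<and> closed A \<and> uminus ` A = A \<and> enat k \<le> genus A}"

text \<open>
  For \<open>1 < p\<close> and \<open>1 \<le> k \<le> |V\<^sub>I|\<close> the family is nonempty and its members are nonempty
  and compact, so the real suprema and infimum below are over nonempty bounded sets;
  they are in fact attained.
\<close>

definition var_eigenvalue ::
  "('v::finite \<times> 'v) set \<Rightarrow> ('v \<Rightarrow> 'v \<Rightarrow> real) \<Rightarrow> 'v set \<Rightarrow> nat \<Rightarrow> real \<Rightarrow> real" where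
  "var_eigenvalue E \<omega> B k p =
     (INF A\<in>genus_family B p k. SUP f\<in>A. rayleigh E \<omega> p f powr p)"

definition Lambda ::
  "('v::finite \<times> 'v) set \<Rightarrow> ('v \<Rightarrow> 'v \<Rightarrow> real) \<Rightarrow> 'v set \<Rightarrow> nat \<Rightarrow> real" where
  "Lambda E \<omega> B k = Lim at_top (\<lambda>p. var_eigenvalue E \<omega> B k p powr (1 / p))"

end

theory Submission
  imports Defs
begin

text \<open>
  Write \<open>\<lambda>\<close> for \<open>\<lambda>\<^sub>k(\<Delta>\<^sub>p)\<close> and \<open>R\<close> for the packing radius \<open>R\<^sub>k\<close>. The limit is squeezed between
  explicit bounds that hold, for finite \<open>R\<close>, for every \<open>p > 1\<close>:
  \<open>|V| powr (-1/p) / R \<le> \<lambda> powr (1/p) \<le> (1 + |E|) powr (1/p) / R\<close>.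
  The powers of the cardinalities are the price of comparing \<open>p\<close>-norms with maximum
  norms, and they tend to 1. If \<open>R\<close> is infinite, the upper bounds below give \<open>\<lambda> = 0\<close>.

  Upper bound. Around the centres \<open>u\<^sub>i\<close> of a packing of radius \<open>r\<close> put the tents
  \<open>max 0 (r - d(u\<^sub>i, x))\<close>. They have disjoint supports and vanish on the boundary, and
  since the centres are at distance at least \<open>2 * r\<close>, a combination \<open>\<Sum> a\<^sub>i T\<^sub>i\<close> has
  gradient at most \<open>max |a\<^sub>i|\<close> even along edges that join two supports
  (\<open>grad_tent_combination_le\<close>), while its value at \<open>u\<^sub>i\<close> is \<open>a\<^sub>i r\<close>. Hence the
  Rayleigh quotient on the unit sphere of their span is at most \<open>1/r\<close>, up to the
  factor above. The genus of this sphere is at least \<open>k\<close>: for \<open>k = 1\<close> because it is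
  nonempty, for \<open>k = 2\<close> because a half circle joins two antipodal points, so that an
  odd real function on it has a zero.

  Lower bound. In every competing set \<open>A\<close> there is an \<open>f\<close> whose maximum modulus \<open>M\<close> is
  attained at \<open>k\<close> nodes, with opposite signs if \<open>k = 2\<close>
  (\<open>balanced_extrema\<close>): for \<open>k = 2\<close> the odd function \<open>max f + min f\<close> must vanish
  somewhere on a set of genus at least 2. If \<open>G\<close> bounds the gradient of \<open>f\<close>, then \<open>f\<close>
  is \<open>G\<close>-Lipschitz for the graph distance, so two nodes with values \<open>M\<close> and \<open>-M\<close> are
  at distance at least \<open>2 * M / G\<close>, and both are at distance at least \<open>M / G\<close> from
  the boundary, where \<open>f = 0\<close>. Thus these nodes form a packing of radius
  \<open>M / G\<close> (\<open>packing_of_balanced_extrema\<close>), which gives \<open>M / G \<le> R\<close>.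
\<close>

section \<open>Path lengths and distances\<close>

lemma path_length_Nil [simp]: "path_length \<omega> [] = 0"
  and path_length_single [simp]: "path_length \<omega> [x] = 0"
  by (simp_all add: path_length_def)

lemma path_length_Cons [simp]:
  "path_length \<omega> (x # y # vs) = inverse (\<omega> x y) + path_length \<omega> (y # vs)"
proof -
  have shift: "path_length \<omega> ws = (\<Sum>i<length ws - 1. inverse (\<omega> (ws ! i) (ws ! Suc i)))" for ws
    unfolding path_length_def
    by (rule sum.reindex_bij_witness[where i = Suc and j = "\<lambda>i. i - 1"]) auto
  show ?thesis
    unfolding shift by (simp add: sum.lessThan_Suc_shift del: sum.lessThan_Suc)
qed

lemma path_length_append:
  assumes "p \<noteq> []" "q \<noteq> []"
  shows "path_length \<omega> (p @ q) =
    path_length \<omega> p + inverse (\<omega> (last p) (hd q)) + path_length \<omega> q"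
  using assms(1)
proof (induction p rule: induct_list012)
  case (2 x)
  then show ?case using assms(2) by (cases q) auto
qed auto

context
  fixes E :: "('v::finite \<times> 'v) set" and \<omega> :: "'v \<Rightarrow> 'v \<Rightarrow> real" and B :: "'v set"
  assumes graph: "weighted_graph E \<omega> B"
begin

lemma edge_sym: "(u, v) \<in> E \<Longrightarrow> (v, u) \<in> E"
  using graph by (auto simp: weighted_graph_def sym_def)

lemma weight_sym: "(u, v) \<in> E \<Longrightarrow> \<omega> u v = \<omega> v u"
  using graph by (auto simp: weighted_graph_def)

lemma weight_pos: "(u, v) \<in> E \<Longrightarrow> 0 < \<omega> u v"
  using graph by (auto simp: weighted_graph_def)

lemma path_length_nonneg: "is_path E vs \<Longrightarrow> 0 \<le> path_length \<omega> vs"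
proof (induction vs rule: induct_list012)
  case (3 x y zs)
  then show ?case
    using weight_pos[of x y] by (auto simp: is_path_def add_nonneg_nonneg less_imp_le)
qed auto

lemma is_path_rev: "is_path E vs \<Longrightarrow> is_path E (rev vs)"
  unfolding is_path_def successively_rev
  by (auto elim: successively_mono intro: edge_sym)

lemma path_length_rev: "is_path E vs \<Longrightarrow> path_length \<omega> (rev vs) = path_length \<omega> vs"
proof (induction vs rule: induct_list012)
  case (3 x y zs)
  then have "path_length \<omega> (rev (y # zs)) = path_length \<omega> (y # zs)" "(x, y) \<in> E"
    by (auto simp: is_path_def)
  moreover have "rev (x # y # zs) = rev (y # zs) @ [x]" by simp
  ultimately show ?case
    by (simp add: path_length_append last_rev weight_sym[of x y] del: rev.simps)
qed auto

lemma graph_dist_le: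
  "is_path E vs \<Longrightarrow> hd vs = u \<Longrightarrow> last vs = v \<Longrightarrow> graph_dist E \<omega> u v \<le> ereal (path_length \<omega> vs)"
  unfolding graph_dist_def by (rule INF_lower) auto

lemma graph_dist_nonneg: "0 \<le> graph_dist E \<omega> u v"
  unfolding graph_dist_def by (rule INF_greatest) (auto simp: path_length_nonneg)

lemma graph_dist_self: "graph_dist E \<omega> u u = 0"
  using graph_dist_le[of "[u]" u u] graph_dist_nonneg[of u u] by (simp add: is_path_def zero_ereal_def)

lemma graph_dist_commute: "graph_dist E \<omega> u v = graph_dist E \<omega> v u"
proof -
  have "graph_dist E \<omega> v u \<le> graph_dist E \<omega> u v" for u v
    unfolding graph_dist_def[of E \<omega> u v]
  proof (rule INF_greatest, clarify)
    fix vs assume "is_path E vs"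
    then show "graph_dist E \<omega> (last vs) (hd vs) \<le> ereal (path_length \<omega> vs)"
      using graph_dist_le[of "rev vs"] is_path_rev[of vs] path_length_rev[of vs]
      by (simp add: is_path_def hd_rev last_rev)
  qed
  then show ?thesis by (simp add: order.antisym)
qed

lemma graph_dist_triangle:
  "graph_dist E \<omega> u v \<le> graph_dist E \<omega> u x + graph_dist E \<omega> x v"
proof (cases "graph_dist E \<omega> u x = \<infinity> \<or> graph_dist E \<omega> x v = \<infinity>")
  case False
  then obtain a b where a: "graph_dist E \<omega> u x = ereal a" and b: "graph_dist E \<omega> x v = ereal b"
    using graph_dist_nonneg[of u x] graph_dist_nonneg[of x v]
    by (cases "graph_dist E \<omega> u x"; cases "graph_dist E \<omega> x v") auto
  have "graph_dist E \<omega> u v \<le> ereal (a + b) + ereal e" if "0 < e" for e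
  proof -
    have "graph_dist E \<omega> u x < ereal (a + e / 2)" "graph_dist E \<omega> x v < ereal (b + e / 2)"
      using a b that by auto
    then obtain p q where
      p: "is_path E p" "hd p = u" "last p = x" "path_length \<omega> p < a + e / 2" and
      q: "is_path E q" "hd q = x" "last q = v" "path_length \<omega> q < b + e / 2"
      unfolding graph_dist_def by (auto simp: INF_less_iff)
    then obtain q' where q': "q = x # q'"
      by (cases q) (auto simp: is_path_def)
    have "p \<noteq> []" using p(1) by (simp add: is_path_def)
    have "is_path E (p @ q')"
      using p(1,3) q(1) q' by (cases q') (auto simp: is_path_def successively_append_iff)
    moreover have "hd (p @ q') = u" "last (p @ q') = v"
      using \<open>p \<noteq> []\<close> p(2,3) q(3) by (auto simp: q')
    ultimately have "graph_dist E \<omega> u v \<le> ereal (path_length \<omega> (p @ q'))"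
      by (rule graph_dist_le)
    also have "path_length \<omega> (p @ q') = path_length \<omega> p + path_length \<omega> q"
      using \<open>p \<noteq> []\<close> p(3) by (cases q') (simp_all add: q' path_length_append)
    also have "ereal \<dots> \<le> ereal (a + b + e)"
      using p q by simp
    finally show ?thesis by simp
  qed
  then have "graph_dist E \<omega> u v \<le> ereal (a + b)"
    by (rule ereal_le_epsilon2)
  then show ?thesis using a b by simp
qed auto

lemma graph_dist_edge: "(x, y) \<in> E \<Longrightarrow> graph_dist E \<omega> x y \<le> ereal (inverse (\<omega> x y))"
  using graph_dist_le[of "[x, y]" x y] by (simp add: is_path_def)

lemma graph_dist_pos:
  obtains m where "0 < m" "\<And>u v. u \<noteq> v \<Longrightarrow> ereal m \<le> graph_dist E \<omega> u v"
proof
  \<comment> \<open>The shortest edge length, capped at 1 so that the minimum exists without edges.\<close>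
  define m where "m = Min (insert 1 ((\<lambda>(x, y). inverse (\<omega> x y)) ` E))"
  show "0 < m"
    unfolding m_def by (subst Min_gr_iff) (auto simp: weight_pos)
  have edge: "m \<le> inverse (\<omega> x y)" if "(x, y) \<in> E" for x y
    unfolding m_def using that by (intro Min_le) auto
  fix u v :: 'v
  assume "u \<noteq> v"
  show "ereal m \<le> graph_dist E \<omega> u v"
    unfolding graph_dist_def
  proof (rule INF_greatest, clarify)
    fix vs assume vs: "is_path E vs" "u = hd vs" "v = last vs"
    with \<open>u \<noteq> v\<close> obtain x y zs where eq: "vs = x # y # zs"
      by (cases vs rule: remdups_adj.cases) (auto simp: is_path_def)
    with vs have "(x, y) \<in> E" "is_path E (y # zs)" by (auto simp: is_path_def)
    then show "ereal m \<le> ereal (path_length \<omega> vs)"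
      using edge[of x y] path_length_nonneg[of "y # zs"] eq by simp
  qed
qed

section \<open>A gradient bound is a Lipschitz bound\<close>

lemma potential_difference_le_path_length:
  assumes G: "\<And>x y. (x, y) \<in> E \<Longrightarrow> \<bar>grad \<omega> f x y\<bar> \<le> G"
  shows "is_path E vs \<Longrightarrow> \<bar>f $ last vs - f $ hd vs\<bar> \<le> G * path_length \<omega> vs"
proof (induction vs rule: induct_list012)
  case (3 x y zs)
  then have xy: "(x, y) \<in> E"
    and IH: "\<bar>f $ last (y # zs) - f $ y\<bar> \<le> G * path_length \<omega> (y # zs)"
    by (auto simp: is_path_def)
  have "\<bar>f $ y - f $ x\<bar> \<le> G * inverse (\<omega> x y)"
    using G[OF xy] weight_pos[OF xy]
    by (simp add: grad_def abs_mult inverse_eq_divide pos_le_divide_eq mult.commute)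
  with IH show ?case by (simp add: algebra_simps)
qed (auto simp: is_path_def)

text \<open>
  The weights are the reciprocals of the edge lengths, so the gradient along an edge is
  a difference quotient; summing along a path turns its bound into a Lipschitz constant.
  The statement divides by \<open>G\<close> so that it also makes sense at infinite distance.
\<close>

lemma lipschitz_graph_dist:
  assumes G: "\<And>x y. (x, y) \<in> E \<Longrightarrow> \<bar>grad \<omega> f x y\<bar> \<le> G" and "0 < G"
  shows "ereal (\<bar>f $ v - f $ u\<bar> / G) \<le> graph_dist E \<omega> u v"
  unfolding graph_dist_def
proof (rule INF_greatest, clarify)
  fix vs assume "is_path E vs"
  from potential_difference_le_path_length[OF G this] \<open>0 < G\<close>
  show "ereal (\<bar>f $ last vs - f $ hd vs\<bar> / G) \<le> ereal (path_length \<omega> vs)"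
    by (simp add: field_simps)
qed

end

section \<open>Packings\<close>

definition packing ::
  "('v \<times> 'v) set \<Rightarrow> ('v \<Rightarrow> 'v \<Rightarrow> real) \<Rightarrow> 'v set \<Rightarrow> nat \<Rightarrow> real \<Rightarrow> (nat \<Rightarrow> 'v) \<Rightarrow> bool" where
  "packing E \<omega> B k r u \<longleftrightarrow> 0 < r \<and> (\<forall>i<k. u i \<in> - B) \<and>
     (\<forall>i<k. \<forall>j<k. i \<noteq> j \<longrightarrow> ereal (2 * r) \<le> graph_dist E \<omega> (u i) (u j)) \<and>
     (\<forall>i<k. ereal r \<le> boundary_dist E \<omega> B (u i))"

lemma packing_radius_eq:
  "packing_radius E \<omega> B k = (SUP r\<in>{r. \<exists>u. packing E \<omega> B k r u}. ereal r)"
  unfolding packing_radius_def packing_def by simp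

text \<open>
  Distinct nodes are at distance at least some \<open>m > 0\<close>, so \<open>k\<close> distinct internal nodes form a packing of radius \<open>m / 2\<close>. This makes the packing radius
  positive, and the families of the variational problem nonempty.
\<close>

lemma packing_exists:
  assumes graph: "weighted_graph E \<omega> (B :: 'v::finite set)" and k: "k \<le> card (- B)"
  obtains r u where "packing E \<omega> B k r u"
proof -
  obtain m where m: "0 < m" "\<And>u v. u \<noteq> v \<Longrightarrow> ereal m \<le> graph_dist E \<omega> u v"
    using graph_dist_pos[OF graph] by blast
  obtain u where u: "bij_betw u {0..<card (- B)} (- B)"
    using ex_bij_betw_nat_finite[of "- B"] by auto
  have "u i \<in> - B" if "i < k" for i
    using u that k by (auto simp: bij_betw_def)
  moreover have "u i \<noteq> u j" if "i < k" "j < k" "i \<noteq> j" for i j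
    using u that k by (auto simp: bij_betw_def inj_on_def)
  moreover have "ereal (m / 2) \<le> boundary_dist E \<omega> B (u i)" if "i < k" for i
    unfolding boundary_dist_def
  proof (rule INF_greatest)
    fix b assume "b \<in> B"
    then have "ereal m \<le> graph_dist E \<omega> (u i) b"
      using m(2)[of "u i" b] calculation(1)[OF that] by auto
    moreover have "ereal (m / 2) \<le> ereal m" using m(1) by simp
    ultimately show "ereal (m / 2) \<le> graph_dist E \<omega> (u i) b" by (rule order.trans[rotated])
  qed
  ultimately have "packing E \<omega> B k (m / 2) u"
    unfolding packing_def using m by simp
  then show thesis by (rule that)
qed

section \<open>The \<open>p\<close>-norms\<close>

lemma abs_le_p_norm:
  assumes "0 < p"
  shows "\<bar>f $ u\<bar> \<le> p_norm p f"
proof -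
  have "\<bar>f $ u\<bar> powr p \<le> (\<Sum>u\<in>UNIV. \<bar>f $ u\<bar> powr p)"
    by (rule member_le_sum) auto
  then have "(\<bar>f $ u\<bar> powr p) powr (1 / p) \<le> p_norm p f"
    unfolding p_norm_def using assms by (intro powr_mono2) auto
  then show ?thesis using assms by (simp add: powr_powr)
qed

lemma p_norm_le:
  fixes f :: "real ^ 'v::finite"
  assumes "0 < p" and M: "\<And>u. \<bar>f $ u\<bar> \<le> M"
  shows "p_norm p f \<le> real CARD('v) powr (1 / p) * M"
proof -
  have "0 \<le> M" using M[of undefined] by linarith
  have "p_norm p f \<le> (\<Sum>u\<in>(UNIV::'v set). M powr p) powr (1 / p)"
    unfolding p_norm_def using assms
    by (intro powr_mono2 sum_mono) (auto intro!: sum_nonneg powr_mono2)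
  also have "\<dots> = real CARD('v) powr (1 / p) * M"
    using assms \<open>0 \<le> M\<close> by (simp add: powr_mult powr_powr)
  finally show ?thesis .
qed

lemma p_norm_nonneg: "0 \<le> p_norm p f"
  by (simp add: p_norm_def)

lemma p_norm_scaleR:
  assumes "0 < p"
  shows "p_norm p (c *\<^sub>R f) = \<bar>c\<bar> * p_norm p f"
  using assms by (simp add: p_norm_def abs_mult powr_mult powr_powr flip: sum_distrib_left)

lemma p_norm_pos:
  assumes "0 < p" and "f $ u \<noteq> 0"
  shows "0 < p_norm p f"
  using abs_le_p_norm[OF assms(1), of f u] assms(2) by linarith

lemma continuous_on_p_norm:
  assumes "0 < p"
  shows "continuous_on S (p_norm p)"
  unfolding p_norm_def using assms
  by (intro continuous_on_powr' continuous_intros) (auto intro: sum_nonneg)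

lemma closed_p_sphere:
  fixes B :: "'v::finite set"
  assumes "0 < p"
  shows "closed (p_sphere B p)"
proof -
  have "closed {f :: real ^ 'v. p_norm p f = 1}"
    using continuous_on_p_norm[OF assms]
    by (intro closed_Collect_eq) auto
  moreover have "closed (H0 B)"
    unfolding H0_def Ball_def
    by (intro closed_Collect_all closed_Collect_imp closed_Collect_eq continuous_intros) auto
  moreover have "p_sphere B p = H0 B \<inter> {f. p_norm p f = 1}" by (auto simp: p_sphere_def)
  ultimately show ?thesis by (simp add: closed_Int)
qed

text \<open>
  An edge that is not a loop is counted twice in the sum over \<open>E\<close>, once in each direction,
  which cancels the factor \<open>1/2\<close> in the \<open>p\<close>-norm of the gradient.
\<close>

lemma grad_le_grad_p_norm:
  assumes graph: "weighted_graph E \<omega> B" and "0 < p" and uv: "(u, v) \<in> E"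
  shows "\<bar>grad \<omega> f u v\<bar> \<le> grad_p_norm E \<omega> p f"
proof (cases "u = v")
  case True
  then show ?thesis by (simp add: grad_def grad_p_norm_def)
next
  case False
  have vu: "(v, u) \<in> E" using edge_sym[OF graph uv] .
  have eq: "\<bar>grad \<omega> f v u\<bar> = \<bar>grad \<omega> f u v\<bar>"
    using weight_sym[OF graph uv] by (simp add: grad_def abs_mult abs_minus_commute)
  have "2 * \<bar>grad \<omega> f u v\<bar> powr p = (\<Sum>(x, y)\<in>{(u, v), (v, u)}. \<bar>grad \<omega> f x y\<bar> powr p)"
    using False eq by simp
  also have "\<dots> \<le> (\<Sum>(x, y)\<in>E. \<bar>grad \<omega> f x y\<bar> powr p)"
    using uv vu by (intro sum_mono2) auto
  finally have "(\<bar>grad \<omega> f u v\<bar> powr p) powr (1 / p) \<le> grad_p_norm E \<omega> p f"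
    unfolding grad_p_norm_def using assms by (intro powr_mono2) auto
  then show ?thesis using assms by (simp add: powr_powr)
qed

text \<open>
  The factor \<open>1 + card E\<close>, rather than \<open>card E\<close>, is positive also for a graph without
  edges, so that its \<open>p\<close>-th root tends to 1 in every case.
\<close>

lemma grad_p_norm_le:
  assumes "0 < p" and "0 \<le> G" and G: "\<And>x y. (x, y) \<in> E \<Longrightarrow> \<bar>grad \<omega> f x y\<bar> \<le> G"
  shows "grad_p_norm E \<omega> p f \<le> real (1 + card E) powr (1 / p) * G"
proof -
  have "(\<Sum>(x, y)\<in>E. \<bar>grad \<omega> f x y\<bar> powr p) \<le> (\<Sum>(x, y)\<in>E. G powr p)"
    using assms by (intro sum_mono) (auto intro!: powr_mono2)
  also have "\<dots> \<le> real (1 + card E) * G powr p"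
    by (simp add: case_prod_unfold mult_right_mono)
  finally have le: "(\<Sum>(x, y)\<in>E. \<bar>grad \<omega> f x y\<bar> powr p) \<le> real (1 + card E) * G powr p" .
  have nonneg: "0 \<le> (\<Sum>(x, y)\<in>E. \<bar>grad \<omega> f x y\<bar> powr p)"
    by (intro sum_nonneg) auto
  have "grad_p_norm E \<omega> p f \<le> (real (1 + card E) * G powr p) powr (1 / p)"
    unfolding grad_p_norm_def using le nonneg assms(1) by (intro powr_mono2) auto
  also have "\<dots> = real (1 + card E) powr (1 / p) * G"
    using assms by (simp add: powr_mult powr_powr)
  finally show ?thesis .
qed

lemma grad_p_norm_nonneg: "0 \<le> grad_p_norm E \<omega> p f"
  by (simp add: grad_p_norm_def)

lemma rayleigh_nonneg: "0 \<le> rayleigh E \<omega> p f"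
  by (simp add: rayleigh_def grad_p_norm_nonneg p_norm_nonneg)

text \<open>
  The suprema that define the eigenvalues are taken in the conditionally complete order of
  the reals; this bound is what makes them meaningful.
\<close>

lemma bdd_above_rayleigh:
  assumes "0 < p" and A: "A \<subseteq> p_sphere B p"
  shows "bdd_above ((\<lambda>f. rayleigh E \<omega> p f powr p) ` A)"
proof -
  define W where "W = (\<Sum>(x, y)\<in>E. \<bar>\<omega> x y\<bar> * 2)"
  have "rayleigh E \<omega> p f \<le> real (1 + card E) powr (1 / p) * W" if "f \<in> A" for f
  proof -
    have norm: "p_norm p f = 1" using that A by (auto simp: p_sphere_def)
    have "\<bar>grad \<omega> f x y\<bar> \<le> W" if "(x, y) \<in> E" for x y
    proof -
      have "\<bar>grad \<omega> f x y\<bar> \<le> \<bar>\<omega> x y\<bar> * 2"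
        unfolding grad_def abs_mult
        using abs_le_p_norm[OF assms(1), of f x] abs_le_p_norm[OF assms(1), of f y] norm
        by (intro mult_left_mono) auto
      also have "\<dots> \<le> W"
        unfolding W_def
        using member_le_sum[OF that, of "\<lambda>(x, y). \<bar>\<omega> x y\<bar> * 2"] by auto
      finally show ?thesis .
    qed
    moreover have "0 \<le> W" unfolding W_def by (intro sum_nonneg) auto
    ultimately show ?thesis
      using grad_p_norm_le[OF assms(1), of W E \<omega> f] norm by (simp add: rayleigh_def)
  qed
  then show ?thesis
    using assms(1) rayleigh_nonneg
    by (intro bdd_aboveI2[where M = "(real (1 + card E) powr (1 / p) * W) powr p"] powr_mono2) auto
qed

section \<open>Genus at least one and at least two\<close>

lemma odd_map_to_punctured_real:
  assumes "continuous_on A g" and "\<And>f. f \<in> A \<Longrightarrow> g f \<noteq> 0" and "\<And>f. f \<in> A \<Longrightarrow> g (- f) = - g f"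
  shows "odd_map_to_punctured A 1 (\<lambda>f i. if i = 0 then g f else (0::real))"
proof -
  have "continuous_map (top_of_set A) euclideanreal (\<lambda>f. if i = 0 then g f else 0)" for i :: nat
    using assms(1) by (cases i) auto
  moreover have "(\<lambda>i. if i = 0 then g f else 0) \<noteq> (\<lambda>_::nat. 0)" if "f \<in> A" for f
    using assms(2)[OF that] by (metis)
  ultimately show ?thesis
    unfolding odd_map_to_punctured_def Euclidean_space_def
    using assms(3)
    by (auto simp: continuous_map_in_subtopology continuous_map_componentwise_UNIV)
qed

lemma genus_le:
  assumes "odd_map_to_punctured A h \<phi>"
  shows "genus A \<le> enat h"
  using assms unfolding genus_def by (auto intro!: Inf_lower)

lemma le_genusI:
  assumes "A \<noteq> {}" and "\<And>h \<phi>. odd_map_to_punctured A h \<phi> \<Longrightarrow> k \<le> h"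
  shows "enat k \<le> genus A"
  using assms unfolding genus_def by (auto intro!: Inf_greatest)

lemma odd_map_to_punctured_nonzero:
  assumes "odd_map_to_punctured A h \<phi>" and "f \<in> A"
  obtains i where "i < h" "\<phi> f i \<noteq> 0"
proof -
  have "\<phi> f \<in> topspace (subtopology (Euclidean_space h) (- {\<lambda>_. 0}))"
    using assms unfolding odd_map_to_punctured_def continuous_map_def by auto
  then have "\<phi> f \<noteq> (\<lambda>_. 0)" "\<forall>i\<ge>h. \<phi> f i = 0"
    by (auto simp: topspace_Euclidean_space)
  then show thesis using that by (metis ext not_le)
qed

lemma odd_map_to_punctured_pos:
  assumes "odd_map_to_punctured A h \<phi>" and "A \<noteq> {}"
  shows "0 < h"
  using assms odd_map_to_punctured_nonzero by (metis ex_in_conv not_less_zero gr0I)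

lemma genus_ge_1: "A \<noteq> {} \<Longrightarrow> enat 1 \<le> genus A"
  by (rule le_genusI) (auto dest: odd_map_to_punctured_pos)

lemma genus_ge_1_nonempty: "enat k \<le> genus A \<Longrightarrow> 1 \<le> k \<Longrightarrow> A \<noteq> {}"
  by (auto simp: genus_def zero_enat_def)

text \<open>
  A zero-free odd real function would be an odd map into the punctured line, and the genus
  would be at most 1.
\<close>

lemma genus_ge_2_odd_zero:
  assumes "enat 2 \<le> genus A" and "continuous_on A g" and "\<And>f. f \<in> A \<Longrightarrow> g (- f) = - (g f :: real)"
  obtains f where "f \<in> A" "g f = 0"
proof -
  have False if "\<And>f. f \<in> A \<Longrightarrow> g f \<noteq> 0"
  proof -
    have "genus A \<le> enat 1"
      using genus_le[OF odd_map_to_punctured_real[OF assms(2) that assms(3)]] .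
    with assms(1) have "enat 2 \<le> enat 1" by (rule order.trans)
    then show False by simp
  qed
  then show thesis using that by blast
qed

text \<open>
  An odd map into the punctured line would have opposite signs at the two ends of the path,
  against the intermediate value theorem. For genus 2 this replaces the Borsuk-Ulam theorem.
\<close>

lemma genus_ge_2_of_path:
  fixes \<gamma> :: "real \<Rightarrow> 'a::real_normed_vector"
  assumes cont: "continuous_on {a..b} \<gamma>" and A: "\<gamma> ` {a..b} \<subseteq> A" and "a \<le> b"
    and antipodal: "\<gamma> b = - \<gamma> a"
  shows "enat 2 \<le> genus A"
proof (rule le_genusI)
  show "A \<noteq> {}" using A \<open>a \<le> b\<close> by auto
  fix h \<phi> assume \<phi>: "odd_map_to_punctured A h \<phi>"
  show "2 \<le> h"
  proof (rule ccontr)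
    assume "\<not> 2 \<le> h"
    with odd_map_to_punctured_pos[OF \<phi> \<open>A \<noteq> {}\<close>] have [simp]: "h = 1" by simp
    have nz: "\<phi> f 0 \<noteq> 0" if "f \<in> A" for f
      using odd_map_to_punctured_nonzero[OF \<phi> that] by auto
    have "continuous_on A (\<lambda>f. \<phi> f 0)"
      using \<phi> unfolding odd_map_to_punctured_def Euclidean_space_def
      by (auto simp: continuous_map_in_subtopology continuous_map_componentwise_UNIV)
    then have "continuous_on {a..b} (\<lambda>t. \<phi> (\<gamma> t) 0)"
      using cont A by (rule continuous_on_compose2)
    then have conn: "connected ((\<lambda>t. \<phi> (\<gamma> t) 0) ` {a..b})"
      by (intro connected_continuous_image) auto
    define s where "s = \<phi> (\<gamma> a) 0"
    have "\<gamma> a \<in> A" using A \<open>a \<le> b\<close> by auto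
    then have "\<phi> (\<gamma> b) 0 = - s"
      using \<phi> unfolding odd_map_to_punctured_def s_def antipodal by auto
    then have "s \<in> (\<lambda>t. \<phi> (\<gamma> t) 0) ` {a..b}" "- s \<in> (\<lambda>t. \<phi> (\<gamma> t) 0) ` {a..b}"
      using \<open>a \<le> b\<close> unfolding s_def by (force+)
    then have "0 \<in> (\<lambda>t. \<phi> (\<gamma> t) 0) ` {a..b}"
      using connectedD_interval[OF conn, of s "- s" 0] connectedD_interval[OF conn, of "- s" s 0]
      by linarith
    then show False using nz A by auto
  qed
qed


section \<open>The lower bound: balancing the extrema\<close>

lemma exists_abs_max:
  fixes f :: "real ^ 'v::finite"
  obtains u where "\<And>x. \<bar>f $ x\<bar> \<le> \<bar>f $ u\<bar>"
proof -
  have "Max (range (\<lambda>x. \<bar>f $ x\<bar>)) \<in> range (\<lambda>x. \<bar>f $ x\<bar>)" by (rule Max_in) auto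
  then obtain u where "Max (range (\<lambda>x. \<bar>f $ x\<bar>)) = \<bar>f $ u\<bar>" by (rule imageE)
  then show thesis using that by (metis Max_ge finite finite_imageI rangeI)
qed

text \<open>
  For \<open>k = 1\<close> any member of \<open>A\<close> will do. For \<open>k = 2\<close> the function
  \<open>g f = max f - max (- f) = max f + min f\<close> is odd and continuous; at a zero of it the
  maximum and the minimum of \<open>f\<close> are \<open>M\<close> and \<open>- M\<close>.
\<close>

lemma balanced_extrema:
  assumes "k \<in> {1, 2}" and A: "A \<in> genus_family B p k" and "0 < p"
  obtains f M u where "f \<in> A" "0 < M" "\<And>x. \<bar>f $ x\<bar> \<le> M"
    "\<And>i. i < k \<Longrightarrow> \<bar>f $ u i\<bar> = M"
    "\<And>i j. i < k \<Longrightarrow> j < k \<Longrightarrow> i \<noteq> j \<Longrightarrow> \<bar>f $ u i - f $ u j\<bar> = 2 * M"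
proof -
  have genus: "enat k \<le> genus A" and sub: "A \<subseteq> p_sphere B p"
    using A by (auto simp: genus_family_def)
  have pos: "0 < M" if "f \<in> A" and "\<And>x. \<bar>f $ x\<bar> \<le> M" for f and M :: real
  proof (rule ccontr)
    assume "\<not> 0 < M"
    then have "f $ x = 0" for x
      using that(2)[of x] by linarith
    then have "p_norm p f = 0" using \<open>0 < p\<close> by (simp add: p_norm_def)
    then show False using that(1) sub by (auto simp: p_sphere_def)
  qed
  consider "k = 1" | "k = 2" using assms(1) by auto
  then show thesis
  proof cases
    case 1
    obtain f where f: "f \<in> A"
      using genus_ge_1_nonempty[OF genus] 1 by auto
    obtain v where v: "\<And>x. \<bar>f $ x\<bar> \<le> \<bar>f $ v\<bar>" using exists_abs_max[of f] by blast
    show thesis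
      by (rule that[OF f pos[OF f v] v, of "\<lambda>_. v"]) (use 1 in auto)
  next
    case 2
    define g where "g f = Max (range (\<lambda>x. f $ x)) - Max (range (\<lambda>x. (- f) $ x))" for f :: "real ^ 'a"
    have max_cont: "continuous_on S (\<lambda>f. Max ((\<lambda>x. h f $ x) ` X))"
      if "continuous_on S h" "X \<noteq> {}"
      for S and h :: "real ^ 'a \<Rightarrow> real ^ 'a" and X :: "'a set"
    proof -
      have "finite X" by simp
      then show ?thesis using that(2)
      proof (induction X rule: finite_ne_induct)
        case (insert x F)
        then have "(\<lambda>f. Max ((\<lambda>x. h f $ x) ` insert x F)) =
            (\<lambda>f. max (h f $ x) (Max ((\<lambda>x. h f $ x) ` F)))" by auto
        then show ?case
          using insert that(1) by (auto intro!: continuous_intros)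
      qed (use that(1) in \<open>auto intro!: continuous_intros\<close>)
    qed
    have "continuous_on A g"
      unfolding g_def by (intro continuous_intros max_cont) auto
    moreover have "g (- f) = - g f" for f by (simp add: g_def)
    ultimately obtain f where f: "f \<in> A" "g f = 0"
      using genus_ge_2_odd_zero[of A g] genus 2 by auto
    define M where "M = Max (range (\<lambda>x. f $ x))"
    have M': "M = Max (range (\<lambda>x. (- f) $ x))"
      using f(2) by (simp add: g_def M_def)
    have "f $ x \<le> M" "(- f) $ x \<le> M" for x
      by (simp add: M_def) (use M' in simp)
    then have bound: "\<bar>f $ x\<bar> \<le> M" for x by (simp add: abs_le_iff)
    have "M \<in> range (\<lambda>x. f $ x)" unfolding M_def by (rule Max_in) auto
    moreover have "M \<in> range (\<lambda>x. (- f) $ x)" unfolding M' by (rule Max_in) auto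
    ultimately obtain v w where "f $ v = M" "f $ w = - M" by fastforce
    moreover have "0 < M" using pos[OF f(1) bound] .
    ultimately show thesis
      by (intro that[OF f(1) _ bound, of "\<lambda>i. if i = 0 then v else w"]) (use 2 in auto)
  qed
qed

text \<open>
  Between nodes with values \<open>M\<close> and \<open>- M\<close>, and from such nodes to the boundary, the Lipschitz
  bound of \<open>f\<close> forces long distances. As \<open>G\<close> is any positive bound of the gradient, the case of
  a vanishing gradient, in which the nodes are at infinite distance from each other
  and from the boundary, needs no separate treatment.
\<close>

lemma packing_of_balanced_extrema:
  assumes graph: "weighted_graph E \<omega> B" and f: "f \<in> H0 B"
    and G: "\<And>x y. (x, y) \<in> E \<Longrightarrow> \<bar>grad \<omega> f x y\<bar> \<le> G" "0 < G" and "0 < M"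
    and u: "\<And>i. i < k \<Longrightarrow> \<bar>f $ u i\<bar> = M"
    and uu: "\<And>i j. i < k \<Longrightarrow> j < k \<Longrightarrow> i \<noteq> j \<Longrightarrow> \<bar>f $ u i - f $ u j\<bar> = 2 * M"
  shows "packing E \<omega> B k (M / G) u"
  unfolding packing_def
proof (intro conjI allI impI)
  show "0 < M / G" using assms by simp
next
  fix i assume "i < k"
  then show "u i \<in> - B" using u[of i] f \<open>0 < M\<close> by (auto simp: H0_def)
  show "ereal (M / G) \<le> boundary_dist E \<omega> B (u i)"
    unfolding boundary_dist_def
  proof (rule INF_greatest)
    fix b assume "b \<in> B"
    then show "ereal (M / G) \<le> graph_dist E \<omega> (u i) b"
      using lipschitz_graph_dist[OF graph G, of b "u i"] f u[OF \<open>i < k\<close>] by (auto simp: H0_def)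
  qed
next
  fix i j assume "i < k" "j < k" "i \<noteq> j"
  then show "ereal (2 * (M / G)) \<le> graph_dist E \<omega> (u i) (u j)"
    using lipschitz_graph_dist[OF graph G, of "u j" "u i"] uu[of j i] by simp
qed

text \<open>
  Every \<open>G\<close> above the \<open>p\<close>-norm of the gradient bounds the gradient on all edges, so
  \<open>M / G \<le> R\<close> by the packing constructed from the extrema; letting \<open>G\<close> decrease gives
  \<open>M / R\<close> as a lower bound of that norm. The normalisation of \<open>f\<close> bounds \<open>M\<close> from below.
\<close>

lemma var_eigenvalue_lower:
  fixes E :: "('v::finite \<times> 'v) set"
  assumes graph: "weighted_graph E \<omega> B" and k: "k \<in> {1, 2}" and p: "1 < p"
    and R: "0 < R" "\<And>r u. packing E \<omega> B k r u \<Longrightarrow> r \<le> R"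
    and ne: "genus_family B p k \<noteq> {}"
  shows "real CARD('v) powr (- (1 / p)) / R \<le> var_eigenvalue E \<omega> B k p powr (1 / p)"
proof -
  define c where "c = real CARD('v) powr (- (1 / p)) / R"
  have c: "0 < c" using R by (simp add: c_def)
  have "c powr p \<le> (SUP f\<in>A. rayleigh E \<omega> p f powr p)" if A: "A \<in> genus_family B p k" for A
  proof -
    have "0 < p" using p by simp
    obtain f M u where f: "f \<in> A" and M: "0 < M" "\<And>x. \<bar>f $ x\<bar> \<le> M"
      and u: "\<And>i. i < k \<Longrightarrow> \<bar>f $ u i\<bar> = M"
        "\<And>i j. i < k \<Longrightarrow> j < k \<Longrightarrow> i \<noteq> j \<Longrightarrow> \<bar>f $ u i - f $ u j\<bar> = 2 * M"
      using balanced_extrema[OF k A \<open>0 < p\<close>] by blast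
    have H0: "f \<in> H0 B" and norm: "p_norm p f = 1" and sub: "A \<subseteq> p_sphere B p"
      using A f by (auto simp: genus_family_def p_sphere_def)
    define G0 where "G0 = grad_p_norm E \<omega> p f"
    have "M \<le> R * G" if "G0 < G" for G
    proof -
      have G: "0 < G" using that grad_p_norm_nonneg[of E \<omega> p f] by (simp add: G0_def)
      have "\<bar>grad \<omega> f x y\<bar> \<le> G" if "(x, y) \<in> E" for x y
        using grad_le_grad_p_norm[OF graph \<open>0 < p\<close> that, of f] \<open>G0 < G\<close> by (simp add: G0_def)
      then have "packing E \<omega> B k (M / G) u"
        using graph H0 G M(1) u by (intro packing_of_balanced_extrema) auto
      then have "M / G \<le> R" by (rule R(2))
      then show ?thesis using G by (simp add: pos_divide_le_eq)
    qed
    then have "M / R \<le> G" if "G0 < G" for G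
      using that R(1) by (simp add: field_simps)
    then have "M / R \<le> G0" by (rule dense_ge)
    moreover have "real CARD('v) powr (- (1 / p)) \<le> M"
      using p_norm_le[OF \<open>0 < p\<close> M(2)] norm by (simp add: powr_minus field_simps)
    ultimately have "c \<le> rayleigh E \<omega> p f"
      using R(1) norm unfolding c_def rayleigh_def G0_def
      by (simp add: divide_right_mono order.trans[of _ "M / R"])
    then have "c powr p \<le> rayleigh E \<omega> p f powr p"
      using c p by (intro powr_mono2) auto
    also have "\<dots> \<le> (SUP f\<in>A. rayleigh E \<omega> p f powr p)"
      using f bdd_above_rayleigh[OF \<open>0 < p\<close> sub] by (intro cSUP_upper) auto
    finally show ?thesis .
  qed
  then have "c powr p \<le> var_eigenvalue E \<omega> B k p"
    unfolding var_eigenvalue_def using ne by (intro cINF_greatest) auto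
  then have "(c powr p) powr (1 / p) \<le> var_eigenvalue E \<omega> B k p powr (1 / p)"
    using p by (intro powr_mono2) auto
  then show ?thesis using p c R(1) by (simp add: powr_powr c_def)
qed

section \<open>The upper bound: tents over a packing\<close>

text \<open>
  This is \<open>max 0 (r - d(u, x))\<close>. The distance is truncated at \<open>r\<close> before it is converted to a
  real number, since the conversion would send an infinite distance to 0.
\<close>

definition tent ::
  "('v::finite \<times> 'v) set \<Rightarrow> ('v \<Rightarrow> 'v \<Rightarrow> real) \<Rightarrow> real \<Rightarrow> 'v \<Rightarrow> real ^ 'v" where
  "tent E \<omega> r u = (\<chi> x. r - real_of_ereal (min (ereal r) (graph_dist E \<omega> u x)))"

lemma subspace_combinations:
  fixes F :: "nat \<Rightarrow> 'a::real_vector"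
  shows "subspace {f. \<exists>a. f = (\<Sum>j<k. a j *\<^sub>R F j)}"
proof (rule subspaceI; clarify)
  show "\<exists>a. 0 = (\<Sum>j<k. a j *\<^sub>R F j)" by (rule exI[of _ "\<lambda>_. 0"]) simp
  show "\<exists>c. (\<Sum>j<k. a j *\<^sub>R F j) + (\<Sum>j<k. b j *\<^sub>R F j) = (\<Sum>j<k. c j *\<^sub>R F j)" for a b
    by (rule exI[of _ "\<lambda>j. a j + b j"]) (simp add: scaleR_left_distrib sum.distrib)
  show "\<exists>b. c *\<^sub>R (\<Sum>j<k. a j *\<^sub>R F j) = (\<Sum>j<k. b j *\<^sub>R F j)" for c a
    by (rule exI[of _ "\<lambda>j. c * a j"]) (simp add: scaleR_sum_right)
qed

lemma tent_far: "ereal r \<le> graph_dist E \<omega> u x \<Longrightarrow> tent E \<omega> r u $ x = 0"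
  by (simp add: tent_def min_def)

context
  fixes E :: "('v::finite \<times> 'v) set" and \<omega> :: "'v \<Rightarrow> 'v \<Rightarrow> real" and B :: "'v set" and r :: real
  assumes graph: "weighted_graph E \<omega> B" and r: "0 < r"
begin

lemma tent_ge:
  assumes "graph_dist E \<omega> u x \<le> ereal s"
  shows "r - s \<le> tent E \<omega> r u $ x"
  using assms graph_dist_nonneg[OF graph, of u x]
  by (cases "graph_dist E \<omega> u x") (auto simp: tent_def min_def)

lemma tent_nonneg: "0 \<le> tent E \<omega> r u $ x"
  using graph_dist_nonneg[OF graph, of u x] r
  by (cases "graph_dist E \<omega> u x") (auto simp: tent_def min_def)

lemma tent_centre: "tent E \<omega> r u $ u = r"
  using r by (simp add: tent_def graph_dist_self[OF graph] min_def)

lemma graph_dist_of_tent: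
  assumes "tent E \<omega> r u $ x \<noteq> 0"
  shows "graph_dist E \<omega> u x = ereal (r - tent E \<omega> r u $ x)"
  using assms graph_dist_nonneg[OF graph, of u x]
  by (cases "graph_dist E \<omega> u x") (auto simp: tent_def min_def split: if_splits)

lemma tent_lipschitz:
  assumes xy: "(x, y) \<in> E"
  shows "tent E \<omega> r u $ x - tent E \<omega> r u $ y \<le> inverse (\<omega> x y)"
proof (cases "tent E \<omega> r u $ x = 0")
  case True
  moreover have "0 < inverse (\<omega> x y)" using weight_pos[OF graph xy] by simp
  ultimately show ?thesis using tent_nonneg[of u y] by linarith
next
  case False
  have "graph_dist E \<omega> u y \<le> graph_dist E \<omega> u x + graph_dist E \<omega> x y"
    by (rule graph_dist_triangle[OF graph])
  also have "\<dots> \<le> ereal (r - tent E \<omega> r u $ x) + ereal (inverse (\<omega> x y))"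
    using graph_dist_of_tent[OF False] graph_dist_edge[OF graph xy] by (intro add_mono) auto
  finally have "graph_dist E \<omega> u y \<le> ereal (r - tent E \<omega> r u $ x + inverse (\<omega> x y))"
    by simp
  from tent_ge[OF this] show ?thesis by linarith
qed

lemma tent_disjoint:
  assumes sep: "ereal (2 * r) \<le> graph_dist E \<omega> u v" and x: "tent E \<omega> r u $ x \<noteq> 0"
  shows "tent E \<omega> r v $ x = 0"
proof (rule ccontr)
  assume x': "tent E \<omega> r v $ x \<noteq> 0"
  have "ereal (2 * r) \<le> graph_dist E \<omega> u x + graph_dist E \<omega> x v"
    using order.trans[OF sep graph_dist_triangle[OF graph, of u v x]] .
  then have "ereal (2 * r) \<le> ereal (r - tent E \<omega> r u $ x) + ereal (r - tent E \<omega> r v $ x)"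
    unfolding graph_dist_commute[OF graph, of x v] graph_dist_of_tent[OF x] graph_dist_of_tent[OF x'] .
  then have "2 * r \<le> r - tent E \<omega> r u $ x + (r - tent E \<omega> r v $ x)"
    by (simp only: plus_ereal.simps ereal_less_eq)
  moreover have "0 < tent E \<omega> r u $ x" "0 < tent E \<omega> r v $ x"
    using tent_nonneg x x' by (simp_all add: order.not_eq_order_implies_strict)
  ultimately show False by linarith
qed

text \<open>
  The two tents at the ends of an edge that joins their supports: the path from \<open>u\<close> to \<open>v\<close>
  through this edge has length at least \<open>2 * r\<close>, and the tents measure how much of the
  \<open>2 * r\<close> remains for the edge itself.
\<close>

lemma tent_sum_le:
  assumes sep: "ereal (2 * r) \<le> graph_dist E \<omega> u v" and xy: "(x, y) \<in> E"
    and x: "tent E \<omega> r u $ x \<noteq> 0" and y: "tent E \<omega> r v $ y \<noteq> 0"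
  shows "tent E \<omega> r u $ x + tent E \<omega> r v $ y \<le> inverse (\<omega> x y)"
proof -
  have "ereal (2 * r) \<le> graph_dist E \<omega> u x + graph_dist E \<omega> x v"
    using order.trans[OF sep graph_dist_triangle[OF graph, of u v x]] .
  also have "\<dots> \<le> graph_dist E \<omega> u x + (ereal (inverse (\<omega> x y)) + graph_dist E \<omega> y v)"
    using graph_dist_edge[OF graph xy]
    by (intro add_left_mono order.trans[OF graph_dist_triangle[OF graph, of x v y]] add_right_mono)
  finally show ?thesis
    unfolding graph_dist_commute[OF graph, of y v] graph_dist_of_tent[OF x] graph_dist_of_tent[OF y]
      plus_ereal.simps ereal_less_eq by linarith
qed

lemma tent_combination_at:
  fixes k :: nat
  assumes packing: "packing E \<omega> B k r u" and "1 \<le> k"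
  obtains i where "i < k" "\<And>j. j < k \<Longrightarrow> j \<noteq> i \<Longrightarrow> tent E \<omega> r (u j) $ x = 0"
    "\<And>a. (\<Sum>j<k. a j *\<^sub>R tent E \<omega> r (u j)) $ x = a i * tent E \<omega> r (u i) $ x"
proof -
  obtain i where i: "i < k" "\<And>j. j < k \<Longrightarrow> j \<noteq> i \<Longrightarrow> tent E \<omega> r (u j) $ x = 0"
  proof (cases "\<exists>i<k. tent E \<omega> r (u i) $ x \<noteq> 0")
    case True
    then obtain i where "i < k" "tent E \<omega> r (u i) $ x \<noteq> 0" by blast
    moreover have "tent E \<omega> r (u j) $ x = 0" if "j < k" "j \<noteq> i" for j
      using packing that calculation by (intro tent_disjoint[of "u i"]) (auto simp: packing_def)
    ultimately show thesis using that by blast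
  next
    case False
    then show thesis using that[of 0] \<open>1 \<le> k\<close> by auto
  qed
  moreover have "(\<Sum>j<k. a j *\<^sub>R tent E \<omega> r (u j)) $ x = a i * tent E \<omega> r (u i) $ x" for a
  proof -
    have "(\<Sum>j<k. a j * tent E \<omega> r (u j) $ x) = (\<Sum>j\<in>{i}. a j * tent E \<omega> r (u j) $ x)"
      using i by (intro sum.mono_neutral_right) auto
    then show ?thesis by simp
  qed
  ultimately show thesis by (rule that)
qed

text \<open>
  At each end of the edge at most one tent is nonzero. If the same tent serves both ends, its
  Lipschitz bound suffices; if two different tents are involved, the values at the ends may
  have opposite signs and add up, which is where the separation \<open>2 * r\<close> of the centres
  enters through \<open>tent_sum_le\<close>.
\<close>

lemma grad_tent_combination_le:
  assumes packing: "packing E \<omega> B k r u" and "1 \<le> k" and xy: "(x, y) \<in> E"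
    and a: "\<And>i. i < k \<Longrightarrow> \<bar>a i\<bar> \<le> C"
  shows "\<bar>grad \<omega> (\<Sum>i<k. a i *\<^sub>R tent E \<omega> r (u i)) x y\<bar> \<le> C"
proof -
  let ?F = "\<lambda>i. tent E \<omega> r (u i)"
  define f where "f = (\<Sum>i<k. a i *\<^sub>R ?F i)"
  obtain i where i: "i < k" "\<And>j. j < k \<Longrightarrow> j \<noteq> i \<Longrightarrow> ?F j $ x = 0" "f $ x = a i * ?F i $ x"
    unfolding f_def using tent_combination_at[OF packing \<open>1 \<le> k\<close>, of x] by metis
  obtain j where j: "j < k" "\<And>i. i < k \<Longrightarrow> i \<noteq> j \<Longrightarrow> ?F i $ y = 0" "f $ y = a j * ?F j $ y"
    unfolding f_def using tent_combination_at[OF packing \<open>1 \<le> k\<close>, of y] by metis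
  have C: "0 \<le> C" using a[OF i(1)] by linarith
  have w: "0 < \<omega> x y" using weight_pos[OF graph xy] .
  have single: "\<bar>f $ y - f $ x\<bar> \<le> C * inverse (\<omega> x y)"
    if "l < k" "f $ x = a l * ?F l $ x" "f $ y = a l * ?F l $ y" for l
  proof -
    have "\<bar>?F l $ y - ?F l $ x\<bar> \<le> inverse (\<omega> x y)"
      using tent_lipschitz[OF xy, of "u l"] tent_lipschitz[OF edge_sym[OF graph xy], of "u l"]
        weight_sym[OF graph xy] by (simp add: abs_le_iff)
    then have "\<bar>a l\<bar> * \<bar>?F l $ y - ?F l $ x\<bar> \<le> C * inverse (\<omega> x y)"
      using a[OF that(1)] C by (intro mult_mono) auto
    then show ?thesis using that by (simp flip: abs_mult right_diff_distrib)
  qed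
  have "\<bar>f $ y - f $ x\<bar> \<le> C * inverse (\<omega> x y)"
  proof (cases "i \<noteq> j \<and> ?F i $ x \<noteq> 0 \<and> ?F j $ y \<noteq> 0")
    case True
    have "\<bar>f $ y - f $ x\<bar> \<le> \<bar>a j\<bar> * ?F j $ y + \<bar>a i\<bar> * ?F i $ x"
      using abs_triangle_ineq4[of "f $ y" "f $ x"] tent_nonneg i(3) j(3) by (simp add: abs_mult)
    also have "\<dots> \<le> C * ?F j $ y + C * ?F i $ x"
      using a[OF i(1)] a[OF j(1)] tent_nonneg by (intro add_mono mult_right_mono) auto
    also have "\<dots> = C * (?F i $ x + ?F j $ y)" by (simp add: algebra_simps)
    also have "\<dots> \<le> C * inverse (\<omega> x y)"
      using packing i(1) j(1) True xy C unfolding packing_def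
      by (intro mult_left_mono tent_sum_le) auto
    finally show ?thesis .
  next
    case False
    then consider "i = j" | "i \<noteq> j" "?F i $ x = 0" | "i \<noteq> j" "?F j $ y = 0" by blast
    then show ?thesis
    proof cases
      case 1
      then show ?thesis using i j by (intro single[of i]) auto
    next
      case 2
      then show ?thesis using i j by (intro single[of j]) auto
    next
      case 3
      then show ?thesis using i j by (intro single[of i]) auto
    qed
  qed
  then show ?thesis
    using w unfolding f_def[symmetric] grad_def abs_mult
    by (simp add: inverse_eq_divide pos_le_divide_eq mult.commute)
qed

lemma tent_combination_at_centre:
  assumes packing: "packing E \<omega> B k r u" and i: "i < k"
  shows "(\<Sum>j<k. a j *\<^sub>R tent E \<omega> r (u j)) $ u i = a i * r"
proof -
  have "tent E \<omega> r (u j) $ u i = 0" if "j < k" "j \<noteq> i" for j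
    using tent_disjoint[of "u i" "u j" "u i"] packing that i r
    by (auto simp: packing_def tent_centre)
  then have "(\<Sum>j<k. a j * tent E \<omega> r (u j) $ u i) = (\<Sum>j\<in>{i}. a j * tent E \<omega> r (u j) $ u i)"
    using i by (intro sum.mono_neutral_right) auto
  then show ?thesis by (simp add: tent_centre)
qed

lemma tent_combination_H0:
  assumes packing: "packing E \<omega> B k r u"
  shows "(\<Sum>j<k. a j *\<^sub>R tent E \<omega> r (u j)) \<in> H0 B"
proof -
  have "tent E \<omega> r (u j) $ b = 0" if "j < k" "b \<in> B" for j b
  proof (rule tent_far)
    have "ereal r \<le> boundary_dist E \<omega> B (u j)" using packing that by (auto simp: packing_def)
    also have "\<dots> \<le> graph_dist E \<omega> (u j) b"
      unfolding boundary_dist_def using that by (intro INF_lower)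
    finally show "ereal r \<le> graph_dist E \<omega> (u j) b" .
  qed
  then show ?thesis by (simp add: H0_def)
qed

definition tent_sphere :: "real \<Rightarrow> nat \<Rightarrow> (nat \<Rightarrow> 'v) \<Rightarrow> (real ^ 'v) set" where
  "tent_sphere p k u = p_sphere B p \<inter> {f. \<exists>a. f = (\<Sum>j<k. a j *\<^sub>R tent E \<omega> r (u j))}"

text \<open>
  The value at \<open>u i\<close> is \<open>a i * r\<close> and is at most the \<open>p\<close>-norm, which is 1. So all
  coefficients, and with them the gradient, are at most \<open>1 / r\<close>.
\<close>

lemma rayleigh_tent_sphere_le:
  assumes packing: "packing E \<omega> B k r u" and "1 \<le> k" and "0 < p" and f: "f \<in> tent_sphere p k u"
  shows "rayleigh E \<omega> p f \<le> real (1 + card E) powr (1 / p) / r"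
proof -
  obtain a where a: "f = (\<Sum>j<k. a j *\<^sub>R tent E \<omega> r (u j))" and norm: "p_norm p f = 1"
    using f by (auto simp: tent_sphere_def p_sphere_def)
  have "\<bar>a i\<bar> \<le> 1 / r" if "i < k" for i
    using abs_le_p_norm[OF \<open>0 < p\<close>, of f "u i"] norm tent_combination_at_centre[OF packing that, of a] r
    by (simp add: a[symmetric] abs_mult field_simps)
  then have "\<bar>grad \<omega> f x y\<bar> \<le> 1 / r" if "(x, y) \<in> E" for x y
    unfolding a using grad_tent_combination_le[OF packing \<open>1 \<le> k\<close> that] by blast
  then show ?thesis
    using grad_p_norm_le[OF \<open>0 < p\<close>, of "1 / r" E \<omega> f] r norm by (simp add: rayleigh_def)
qed

lemma normalized_in_tent_sphere:
  assumes packing: "packing E \<omega> B k r u" and "0 < p" and i: "i < k" "a i \<noteq> 0"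
    and f: "f = (\<Sum>j<k. a j *\<^sub>R tent E \<omega> r (u j))"
  shows "0 < p_norm p f" and "inverse (p_norm p f) *\<^sub>R f \<in> tent_sphere p k u"
proof -
  have "f $ u i \<noteq> 0" using tent_combination_at_centre[OF packing i(1), of a] i r f by simp
  then show pos: "0 < p_norm p f" using \<open>0 < p\<close> by (rule p_norm_pos[rotated])
  have "inverse (p_norm p f) *\<^sub>R f = (\<Sum>j<k. (inverse (p_norm p f) * a j) *\<^sub>R tent E \<omega> r (u j))"
    unfolding f by (simp add: scaleR_sum_right)
  moreover have "f \<in> H0 B"
    unfolding f by (rule tent_combination_H0[OF packing])
  then have "inverse (p_norm p f) *\<^sub>R f \<in> H0 B" by (simp add: H0_def)
  moreover have "p_norm p (inverse (p_norm p f) *\<^sub>R f) = 1"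
    using pos \<open>0 < p\<close> by (simp add: p_norm_scaleR)
  ultimately show "inverse (p_norm p f) *\<^sub>R f \<in> tent_sphere p k u"
    unfolding tent_sphere_def p_sphere_def
    by (intro IntI CollectI conjI exI[of _ "\<lambda>j. inverse (p_norm p f) * a j"])
qed

text \<open>
  For \<open>k = 2\<close> the normalised combinations with coefficients \<open>cos t\<close> and \<open>sin t\<close>, for \<open>t\<close>
  from 0 to \<open>pi\<close>, form a path between antipodal points.
\<close>

lemma tent_sphere_in_genus_family:
  assumes packing: "packing E \<omega> B k r u" and k: "k \<in> {1, 2}" and p: "0 < p"
  shows "tent_sphere p k u \<in> genus_family B p k"
proof -
  have "closed (tent_sphere p k u)"
    unfolding tent_sphere_def using p
    by (intro closed_Int closed_p_sphere closed_subspace subspace_combinations)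
  moreover have "- f \<in> tent_sphere p k u" if "f \<in> tent_sphere p k u" for f
    using that subspace_neg[OF subspace_combinations[where k = k and F = "\<lambda>j. tent E \<omega> r (u j)"]]
    unfolding tent_sphere_def by (auto simp: p_sphere_def H0_def p_norm_def)
  then have "uminus ` tent_sphere p k u = tent_sphere p k u"
    by (auto simp: image_iff) (metis minus_minus)
  moreover have "enat k \<le> genus (tent_sphere p k u)"
  proof (cases "k = 1")
    case True
    then show ?thesis
      using normalized_in_tent_sphere(2)[OF packing p, of 0 "\<lambda>_. 1"] genus_ge_1 by auto
  next
    case False
    with k have 2: "k = 2" by simp
    define a where "a t i = (if i = (0::nat) then cos t else sin t)" for t :: real and i
    define f where "f t = (\<Sum>j<k. a t j *\<^sub>R tent E \<omega> r (u j))" for t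
    define \<gamma> where "\<gamma> t = inverse (p_norm p (f t)) *\<^sub>R f t" for t
    have "a t 0 \<noteq> 0 \<or> a t 1 \<noteq> 0" for t
      using sin_zero_abs_cos_one[of t] by (auto simp: a_def)
    moreover have "0 < k" "1 < k" using 2 by simp_all
    ultimately have ai: "\<exists>i<k. a t i \<noteq> 0" for t by metis
    have f_pos: "0 < p_norm p (f t)" and \<gamma>: "\<gamma> t \<in> tent_sphere p k u" for t
    proof -
      obtain i where "i < k" "a t i \<noteq> 0" using ai by blast
      from normalized_in_tent_sphere[OF packing p this f_def[of t]]
      show "0 < p_norm p (f t)" "\<gamma> t \<in> tent_sphere p k u" by (simp_all only: \<gamma>_def)
    qed
    have "continuous_on {0..pi} f"
      unfolding f_def a_def using 2 by (auto simp: numeral_2_eq_2 intro!: continuous_intros)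
    then have "continuous_on {0..pi} \<gamma>"
      unfolding \<gamma>_def using f_pos
      by (intro continuous_on_scaleR continuous_on_inverse
          continuous_on_compose2[OF continuous_on_p_norm[OF p, of UNIV]])
        (auto simp: less_imp_neq[symmetric])
    moreover have "f pi = - f 0"
      unfolding f_def a_def using 2 by (simp add: numeral_2_eq_2)
    then have "\<gamma> pi = - \<gamma> 0"
      unfolding \<gamma>_def by (simp add: p_norm_def)
    ultimately show ?thesis
      unfolding 2[symmetric] using \<gamma> genus_ge_2_of_path[of 0 pi \<gamma>] 2 by auto
  qed
  ultimately show ?thesis
    unfolding genus_family_def by (auto simp: tent_sphere_def)
qed

end

lemma var_eigenvalue_upper:
  assumes graph: "weighted_graph E \<omega> B" and packing: "packing E \<omega> B k r u"
    and k: "k \<in> {1, 2}" and p: "1 < p"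
  shows "genus_family B p k \<noteq> {}"
    and "var_eigenvalue E \<omega> B k p powr (1 / p) \<le> real (1 + card E) powr (1 / p) / r"
proof -
  define c where "c = real (1 + card E) powr (1 / p) / r"
  define A where "A = tent_sphere E \<omega> B r p k u"
  have r: "0 < r" and p0: "0 < p" using packing p by (auto simp: packing_def)
  have A: "A \<in> genus_family B p k"
    unfolding A_def using tent_sphere_in_genus_family[OF graph r packing k p0] .
  then show "genus_family B p k \<noteq> {}" by auto
  have SUP_nonneg: "0 \<le> (SUP f\<in>A. rayleigh E \<omega> p f powr p)" if "A \<in> genus_family B p k" for A
  proof -
    have "A \<noteq> {}" "A \<subseteq> p_sphere B p"
      using that k genus_ge_1_nonempty[of k A] by (auto simp: genus_family_def)
    then show ?thesis
      using bdd_above_rayleigh[OF p0, of A B E \<omega>]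
      by (metis (no_types, lifting) cSUP_upper2 all_not_in_conv powr_ge_zero)
  qed
  have "var_eigenvalue E \<omega> B k p \<le> (SUP f\<in>A. rayleigh E \<omega> p f powr p)"
    unfolding var_eigenvalue_def using A SUP_nonneg by (intro cINF_lower bdd_belowI2) auto
  also have "\<dots> \<le> c powr p"
  proof (rule cSUP_least)
    show "A \<noteq> {}" using A k genus_ge_1_nonempty[of k A] by (auto simp: genus_family_def)
    show "rayleigh E \<omega> p f powr p \<le> c powr p" if "f \<in> A" for f
      unfolding c_def using that k p0 rayleigh_nonneg
      by (intro powr_mono2 rayleigh_tent_sphere_le[OF graph r packing]) (auto simp: A_def)
  qed
  finally have "var_eigenvalue E \<omega> B k p \<le> c powr p" .
  moreover have "0 \<le> var_eigenvalue E \<omega> B k p"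
    unfolding var_eigenvalue_def using A SUP_nonneg by (intro cINF_greatest) auto
  ultimately have "var_eigenvalue E \<omega> B k p powr (1 / p) \<le> (c powr p) powr (1 / p)"
    using p by (intro powr_mono2) auto
  then show "var_eigenvalue E \<omega> B k p powr (1 / p) \<le> c"
    using p r by (simp add: powr_powr c_def)
qed

section \<open>The limit\<close>

lemma tendsto_powr_inverse_exponent:
  assumes "0 < c"
  shows "((\<lambda>p::real. c powr (1 / p)) \<longlongrightarrow> 1) at_top"
    and "((\<lambda>p::real. c powr (- (1 / p))) \<longlongrightarrow> 1) at_top"
proof -
  have "((\<lambda>p::real. 1 / p) \<longlongrightarrow> 0) at_top"
    by (intro tendsto_divide_0[OF tendsto_const] filterlim_at_top_imp_at_infinity filterlim_ident)
  then show "((\<lambda>p::real. c powr (1 / p)) \<longlongrightarrow> 1) at_top"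
    "((\<lambda>p::real. c powr (- (1 / p))) \<longlongrightarrow> 1) at_top"
    using assms tendsto_powr[OF tendsto_const, of _ 0 at_top c]
      tendsto_minus[of "\<lambda>p. 1 / p" 0 at_top] by fastforce+
qed

text \<open>
  If the packing radius is infinite, there are packings of arbitrarily large radius, and the
  upper bounds that they give force the eigenvalue to be 0 for every \<open>p > 1\<close>. Otherwise the
  upper bounds \<open>C / r\<close> pass to the supremum over the radii \<open>r\<close> without the supremum having
  to be attained.
\<close>

lemma tendsto_var_eigenvalue:
  fixes E :: "('v::finite \<times> 'v) set"
  assumes graph: "weighted_graph E \<omega> B" and k: "k \<in> {1, 2}" "k \<le> card (- B)"
  obtains L where "((\<lambda>p. var_eigenvalue E \<omega> B k p powr (1 / p)) \<longlongrightarrow> L) at_top"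
    "ereal L = 1 / packing_radius E \<omega> B k"
proof -
  define l where "l p = var_eigenvalue E \<omega> B k p powr (1 / p)" for p
  obtain r0 u0 where packing0: "packing E \<omega> B k r0 u0"
    using packing_exists[OF graph k(2)] .
  have r0: "0 < r0" using packing0 by (simp add: packing_def)
  have le_radius: "ereal r \<le> packing_radius E \<omega> B k" if "packing E \<omega> B k r u" for r u
    unfolding packing_radius_eq using that by (intro SUP_upper) auto
  show thesis
  proof (cases "packing_radius E \<omega> B k")
    case PInf
    have "l p = 0" if p: "1 < p" for p
    proof (rule ccontr)
      assume "l p \<noteq> 0"
      then have pos: "0 < l p" by (simp add: l_def)
      let ?C = "real (1 + card E) powr (1 / p)"
      have "ereal (?C / l p) < (SUP r\<in>{r. \<exists>u. packing E \<omega> B k r u}. ereal r)"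
        using PInf by (simp add: packing_radius_eq)
      then obtain r u where r: "packing E \<omega> B k r u" "?C / l p < r"
        unfolding less_SUP_iff by auto
      then have "l p \<le> ?C / r" "0 < r"
        using var_eigenvalue_upper(2)[OF graph r(1) k(1) p] by (auto simp: l_def packing_def)
      then show False using pos r(2) by (simp add: field_simps)
    qed
    then have "eventually (\<lambda>p. l p = 0) at_top"
      by (rule eventually_mono[OF eventually_gt_at_top[of 1]])
    then have "(l \<longlongrightarrow> 0) at_top" by (simp add: tendsto_eventually)
    then show thesis using that[of 0] PInf by (simp add: l_def[abs_def] zero_ereal_def)
  next
    case (real R)
    have R: "0 < R" using le_radius[OF packing0] r0 real by simp
    have packing_le: "r \<le> R" if "packing E \<omega> B k r u" for r u
      using le_radius[OF that] real by simp
    have upper: "l p \<le> real (1 + card E) powr (1 / p) / R" if p: "1 < p" for p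
    proof (cases "l p = 0")
      case True
      then show ?thesis using R by simp
    next
      case False
      then have pos: "0 < l p" by (simp add: l_def)
      let ?C = "real (1 + card E) powr (1 / p)"
      have "packing_radius E \<omega> B k \<le> ereal (?C / l p)"
        unfolding packing_radius_eq
      proof (rule SUP_least, clarify)
        fix r u assume packing: "packing E \<omega> B k r u"
        then have "l p \<le> ?C / r" "0 < r"
          using var_eigenvalue_upper(2)[OF graph packing k(1) p] by (auto simp: l_def packing_def)
        then show "ereal r \<le> ereal (?C / l p)" using pos by (simp add: field_simps)
      qed
      then show ?thesis using real pos R by (simp add: field_simps)
    qed
    have lower: "real CARD('v) powr (- (1 / p)) / R \<le> l p" if p: "1 < p" for p
      unfolding l_def
      using var_eigenvalue_lower[OF graph k(1) p R] packing_le
        var_eigenvalue_upper(1)[OF graph packing0 k(1) p] by blast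
    have "(l \<longlongrightarrow> 1 / R) at_top"
    proof (rule tendsto_sandwich)
      show "eventually (\<lambda>p. real CARD('v) powr (- (1 / p)) / R \<le> l p) at_top"
        using eventually_gt_at_top[of 1] by eventually_elim (rule lower)
      show "eventually (\<lambda>p. l p \<le> real (1 + card E) powr (1 / p) / R) at_top"
        using eventually_gt_at_top[of 1] by eventually_elim (rule upper)
    qed (use R in \<open>auto intro!: tendsto_divide tendsto_powr_inverse_exponent simp del: of_nat_add of_nat_Suc\<close>)
    then show thesis using that[of "1 / R"] real R by (simp add: l_def[abs_def] one_ereal_def)
  next
    case MInf
    then show thesis using le_radius[OF packing0] by simp
  qed
qed

theorem theorem3p10:
  fixes E :: "('v::finite \<times> 'v) set" and \<omega> :: "'v \<Rightarrow> 'v \<Rightarrow> real"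
    and B :: "'v set" and k :: nat
  assumes "weighted_graph E \<omega> B" and "connected_graph E B"
    and "k \<in> {1, 2}" and "k \<le> card (- B)"
  shows "((\<lambda>p. var_eigenvalue E \<omega> B k p powr (1 / p)) \<longlongrightarrow> Lambda E \<omega> B k) at_top \<and>
         ereal (Lambda E \<omega> B k) = 1 / packing_radius E \<omega> B k"
proof -
  obtain L where L: "((\<lambda>p. var_eigenvalue E \<omega> B k p powr (1 / p)) \<longlongrightarrow> L) at_top"
    "ereal L = 1 / packing_radius E \<omega> B k"
    using tendsto_var_eigenvalue[OF assms(1,3,4)] .
  then have "Lambda E \<omega> B k = L"
    unfolding Lambda_def by (intro tendsto_Lim) auto
  with L show ?thesis by simp
qed

end
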